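(* Let $n\geq 2$. If $\mathcal{F}\subset 2^{[n]}$ is intersecting, then $\beta(\mathcal{F})\leq 2^{n-3}$.
   Context: $2^{[n]}$ is the power set of $[n]=\{1,\dots,n\}$. A family is intersecting if any two of its members have nonempty intersection. For $\mathcal{F}\subset 2^{[n]}$ and distinct $i,j\in[n]$, let $b_{ij}(\mathcal{F})=|\{F\in\mathcal{F}\colon i\in F,\ j\notin F\}|$; the sturdiness is $\beta(\mathcal{F})=\min_{1\leq i\neq j\leq n} b_{ij}(\mathcal{F})$. *)

theory Defs
  imports Complex_Main
begin

text \<open>The two members may coincide, so an intersecting family does not contain the empty set.\<close>

definition intersecting :: "'a set set \<Rightarrow> bool" where
  "intersecting \<F> \<longleftrightarrow> (\<forall>F\<in>\<F>. \<forall>G\<in>\<F>. F \<inter> G \<noteq> {})"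

definition b_count :: "'a set set \<Rightarrow> 'a \<Rightarrow> 'a \<Rightarrow> nat" where
  "b_count \<F> i j = card {F \<in> \<F>. i \<in> F \<and> j \<notin> F}"

text \<open>The ground set \<open>{1..n}\<close> must be given explicitly, since it is not determined by the family.
  The minimum is over a nonempty set exactly when \<open>n \<ge> 2\<close>; otherwise the value is unspecified.\<close>

definition sturdiness :: "nat \<Rightarrow> nat set set \<Rightarrow> nat" where
  "sturdiness n \<F> = Min {b_count \<F> i j | i j. i \<in> {1..n} \<and> j \<in> {1..n} \<and> i \<noteq> j}"

end

theory Submission
  imports Defs
begin

text \<open>Complementation in the ground set exchanges the sets containing \<open>i\<close> but not \<open>j\<close> with those
  containing \<open>j\<close> but not \<open>i\<close>, and an intersecting family contains at most one set of each
  complementary pair. So \<open>b\<^sub>i\<^sub>j + b\<^sub>j\<^sub>i \<le> 2\<^bsup>n - 2\<^esup>\<close> for all \<open>i \<noteq> j\<close>, and the smaller summand is at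
  most \<open>2\<^bsup>n - 3\<^esup>\<close>.\<close>

text \<open>Removing \<open>i\<close> matches these sets with the arbitrary subsets of
  \<open>X - {i, j}\<close>.\<close>

lemma card_separating_subsets:
  assumes "finite X" "i \<in> X" "j \<in> X" "i \<noteq> j"
  shows "card {F. F \<subseteq> X \<and> i \<in> F \<and> j \<notin> F} = 2 ^ (card X - 2)"
proof -
  have "{F. F \<subseteq> X \<and> i \<in> F \<and> j \<notin> F} = insert i ` Pow (X - {i, j})" (is "?L = ?R")
  proof
    show "?L \<subseteq> ?R"
    proof
      fix F assume "F \<in> ?L"
      then have "F = insert i (F - {i})" "F - {i} \<in> Pow (X - {i, j})"
        by auto
      then show "F \<in> ?R"
        by (rule image_eqI)
    qed
    show "?R \<subseteq> ?L"
      using assms by auto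
  qed
  moreover have "inj_on (insert i) (Pow (X - {i, j}))"
    by (rule inj_onI) blast
  ultimately show ?thesis
    using assms by (simp add: card_image card_Pow card_Diff_subset)
qed

lemma b_count_add_swap_le:
  assumes "finite X" "\<F> \<subseteq> Pow X" "intersecting \<F>" "i \<in> X" "j \<in> X" "i \<noteq> j"
  shows "b_count \<F> i j + b_count \<F> j i \<le> 2 ^ (card X - 2)"
proof -
  let ?A = "{F \<in> \<F>. i \<in> F \<and> j \<notin> F}" and ?B = "{F \<in> \<F>. j \<in> F \<and> i \<notin> F}"
  let ?C = "(-) X ` ?B" and ?S = "{F. F \<subseteq> X \<and> i \<in> F \<and> j \<notin> F}"
  have "inj_on ((-) X) ?B"
    using assms(2) by (intro inj_onI) blast
  then have "card ?B = card ?C"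
    by (simp add: card_image)
  \<comment> \<open>A common member would be \<open>X - G\<close> for some \<open>G\<close> in
    \<open>\<F>\<close>, hence a member of \<open>\<F>\<close> disjoint from
    \<open>G\<close>.\<close>
  have "?A \<inter> ?C = {}"
    using assms(3) unfolding intersecting_def by blast
  have sub: "?A \<union> ?C \<subseteq> ?S"
    using assms by auto
  have "finite ?S"
    using assms(1) by simp
  with sub have "finite ?A" "finite ?C"
    using finite_subset by blast+
  have "card ?A + card ?B = card (?A \<union> ?C)"
    using card_Un_disjoint[OF \<open>finite ?A\<close> \<open>finite ?C\<close> \<open>?A \<inter> ?C = {}\<close>] \<open>card ?B = card ?C\<close> by simp
  also have "\<dots> \<le> card ?S"
    by (rule card_mono[OF \<open>finite ?S\<close> sub])
  finally show ?thesis
    using card_separating_subsets[of X i j] assms by (simp add: b_count_def)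
qed

lemma sturdiness_le_b_count:
  assumes "i \<in> {1..n}" "j \<in> {1..n}" "i \<noteq> j"
  shows "sturdiness n \<F> \<le> b_count \<F> i j"
proof -
  let ?M = "{b_count \<F> i j | i j. i \<in> {1..n} \<and> j \<in> {1..n} \<and> i \<noteq> j}"
  \<comment> \<open>\<open>Min_le\<close> needs a finite set; finitely many pairs index
    \<open>?M\<close>.\<close>
  have "?M \<subseteq> case_prod (b_count \<F>) ` ({1..n} \<times> {1..n})"
    by auto
  then have "finite ?M"
    by (rule finite_subset) simp
  then show ?thesis
    unfolding sturdiness_def using assms by (intro Min_le) auto
qed

theorem theorem1p8:
  fixes n :: nat and \<F> :: "nat set set"
  assumes "n \<ge> 2"
    and "\<F> \<subseteq> Pow {1..n}"
    and "intersecting \<F>"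
  shows "real (sturdiness n \<F>) \<le> 2 powi (int n - 3)"
proof -
  \<comment> \<open>As \<open>n \<ge> 2\<close>, the points 1 and 2 lie in the ground set; any two
    distinct points would do.\<close>
  have "2 * sturdiness n \<F> \<le> b_count \<F> 1 2 + b_count \<F> 2 1"
    using sturdiness_le_b_count[of 1 n 2 \<F>] sturdiness_le_b_count[of 2 n 1 \<F>] assms(1) by simp
  also have "\<dots> \<le> 2 ^ (n - 2)"
    using b_count_add_swap_le[of "{1..n}" \<F> 1 2] assms by simp
  \<comment> \<open>For \<open>n = 2\<close> the target exponent is -1, so the halving is done in
    the reals; \<open>n - 2\<close> is not truncated.\<close>
  finally have "real (2 * sturdiness n \<F>) \<le> real (2 ^ (n - 2))"
    by (rule of_nat_mono)
  also have "real (2 ^ (n - 2)) = 2 powi (int (n - 2))"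
    by simp
  also have "int (n - 2) = int n - 3 + 1"
    using assms(1) by simp
  also have "(2::real) powi (int n - 3 + 1) = 2 * 2 powi (int n - 3)"
    using power_int_add[of "2::real" "int n - 3" 1] by simp
  finally show ?thesis
    by simp
qed

end
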